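(* There is a constant $C>0$ depending only on the dimension $d$ such that the following holds. Let $m\ge 0$ be an integer, let $P\subset\mathbb{R}^d$ be a dyadic cube and let $\mathcal{S}$ be a sparse collection of dyadic cubes $Q$ such that $Q^{(m)}\subseteq P$. Then for every nonnegative integrable function $f$ on $P$ there exists another sparse collection $\mathcal{S}'$ of dyadic subcubes of $P$ such that $$\mathcal{A}^m_{\mathcal{S}} f(x)\le C\,(m+1)\,\mathcal{A}^0_{\mathcal{S}'}f(x)\qquad\text{for all }x\in P.$$
   Context: All dyadic cubes belong to a fixed dyadic grid in $\mathbb{R}^d$ (a dyadic lattice of cubes with sides parallel to the axes). $Q^{(m)}$ is the $m$-th dyadic parent of $Q$, i.e. the unique cube of the grid containing $Q$ with side length $2^m\ell(Q)$ (so $Q^{(0)}=Q$). $\langle f\rangle_Q=\frac{1}{|Q|}\int_Q f$. For a collection $\mathcal{S}$ of dyadic cubes and $m\ge0$, $$\mathcal{A}^m_{\mathcal{S}}f(x)=\sum_{Q\in\mathcal{S}}\langle f\rangle_{Q^{(m)}}\mathbb{1}_Q(x).$$ For $0<\eta<1$, a collection $\mathcal{S}$ of cubes belonging to the same dyadic grid is $\eta$-sparse if for every $Q\in\mathcal{S}$ there is a measurable subset $E(Q)\subset Q$ with $|E(Q)|\ge\eta|Q|$ and $E(Q)\cap E(Q')=\emptyset$ for distinct $Q,Q'\in\mathcal{S}$. A collection is sparse if it is $\frac12$-sparse. *)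

theory Defs
  imports "HOL-Analysis.Analysis"
begin

definition cube :: "real ^ 'n \<Rightarrow> real \<Rightarrow> (real ^ 'n) set" where
  "cube a l = {x. \<forall>i. a $ i \<le> x $ i \<and> x $ i < a $ i + l}"

definition side_length :: "(real ^ 'n) set \<Rightarrow> real" where
  "side_length Q = (THE l. l > 0 \<and> (\<exists>a. Q = cube a l))"

text \<open>
  The number \<open>l0\<close> is the side length of the cubes of generation zero; the usual
  normalisation is \<open>l0 = 1\<close>. Grids need not be the standard one: translated and
  randomised grids are included.
\<close>

definition dyadic_grid :: "(real ^ 'n) set set \<Rightarrow> bool" where
  "dyadic_grid D \<longleftrightarrow>
     (\<exists>l0>0.
        (\<forall>Q\<in>D. \<exists>a. \<exists>k::int. Q = cube a (l0 * 2 powi k)) \<and>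
        (\<forall>k::int. partition_on UNIV {Q \<in> D. \<exists>a. Q = cube a (l0 * 2 powi k)}) \<and>
        (\<forall>Q\<in>D. \<forall>R\<in>D. Q \<inter> R \<in> {{}, Q, R}))"

definition dyadic_parent :: "(real ^ 'n) set set \<Rightarrow> nat \<Rightarrow> (real ^ 'n) set \<Rightarrow> (real ^ 'n) set" where
  "dyadic_parent D m Q = (THE R. R \<in> D \<and> Q \<subseteq> R \<and> side_length R = 2 ^ m * side_length Q)"

definition average :: "(real ^ 'n \<Rightarrow> real) \<Rightarrow> (real ^ 'n) set \<Rightarrow> real" where
  "average f Q = (LINT x:Q|lebesgue. f x) / measure lebesgue Q"

text \<open>
  The sum is taken in \<open>[0, \<infinity>]\<close>, since a point may lie in infinitely many cubes of the
  collection. The operator is only applied to functions that are nonnegative on all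
  cubes involved, so that \<open>ennreal\<close> truncates nothing.
\<close>

definition sparse_op ::
  "(real ^ 'n) set set \<Rightarrow> nat \<Rightarrow> (real ^ 'n) set set \<Rightarrow> (real ^ 'n \<Rightarrow> real) \<Rightarrow> real ^ 'n \<Rightarrow> ennreal" where
  "sparse_op D m S f x = (\<Sum>\<^sub>\<infinity>Q\<in>S. ennreal (average f (dyadic_parent D m Q)) * indicator Q x)"

definition eta_sparse :: "real \<Rightarrow> (real ^ 'n) set set \<Rightarrow> bool" where
  "eta_sparse \<eta> S \<longleftrightarrow>
     (\<exists>E. (\<forall>Q\<in>S. E Q \<in> sets lebesgue \<and> E Q \<subseteq> Q \<and> measure lebesgue (E Q) \<ge> \<eta> * measure lebesgue Q) \<and>
          disjoint_family_on E S)"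

abbreviation sparse_collection :: "(real ^ 'n) set set \<Rightarrow> bool" where
  "sparse_collection \<equiv> eta_sparse (1/2)"

subsection \<open>Well-definedness\<close>

lemma cube_subset_imp_le:
  fixes a b :: "real ^ 'n"
  assumes "cube a l \<subseteq> cube b r" "l > 0"
  shows "l \<le> r"
proof (rule field_le_epsilon)
  fix e :: real assume "e > 0"
  define t where "t = max 0 (l - e)"
  have t: "0 \<le> t" "t < l" "l - e \<le> t"
    using \<open>e > 0\<close> \<open>l > 0\<close> by (auto simp: t_def)
  fix i :: 'n
  have "a \<in> cube a l" "(\<chi> i. a $ i + t) \<in> cube a l"
    using t \<open>l > 0\<close> by (auto simp: cube_def)
  then have "a \<in> cube b r" "(\<chi> i. a $ i + t) \<in> cube b r"
    using assms by auto
  then have "b $ i \<le> a $ i" "a $ i + t < b $ i + r"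
    by (auto simp: cube_def)
  then show "l \<le> r + e" using t by linarith
qed

lemma side_length_cube:
  fixes a :: "real ^ 'n"
  assumes "l > 0"
  shows "side_length (cube a l) = l"
  unfolding side_length_def
proof (rule the_equality)
  fix r assume r: "r > 0 \<and> (\<exists>b. cube a l = cube b r)"
  then obtain b where b: "cube a l = cube b r" by blast
  show "r = l"
    using cube_subset_imp_le[of a l b r] cube_subset_imp_le[of b r a l] b r assms by force
qed (use assms in blast)

lemma dyadic_parent_ex1:
  fixes D :: "(real ^ 'n) set set"
  assumes D: "dyadic_grid D" and Q: "Q \<in> D"
  shows "\<exists>!R. R \<in> D \<and> Q \<subseteq> R \<and> side_length R = 2 ^ m * side_length Q"
proof -
  obtain l0 where l0: "l0 > 0"
    and c: "\<And>Q. Q \<in> D \<Longrightarrow> \<exists>a. \<exists>k::int. Q = cube a (l0 * 2 powi k)"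
    and p: "\<And>k::int. partition_on UNIV {Q \<in> D. \<exists>a. Q = cube a (l0 * 2 powi k)}"
    and n: "\<And>Q R. Q \<in> D \<Longrightarrow> R \<in> D \<Longrightarrow> Q \<inter> R \<in> {{}, Q, R}"
    using D unfolding dyadic_grid_def by auto
  obtain a and k :: int where Qa: "Q = cube a (l0 * 2 powi k)" using c[OF Q] by blast
  let ?l = "l0 * 2 powi k" and ?r = "l0 * 2 powi (k + int m)"
  have r: "?r = 2 ^ m * ?l" by (simp add: power_int_add)
  have pos: "?l > 0" "?r > 0" using l0 by auto
  have sQ: "side_length Q = ?l" using Qa side_length_cube[OF pos(1)] by simp
  have aQ: "a \<in> Q" using pos Qa by (auto simp: cube_def)
  have "\<Union>{Q \<in> D. \<exists>a. Q = cube a ?r} = UNIV" using p[of "k + int m"] by (simp add: partition_on_def)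
  then obtain R b where R: "a \<in> R" "R \<in> D" "R = cube b ?r" by blast
  have sR: "side_length R = 2 ^ m * side_length Q"
    using R(3) side_length_cube[OF pos(2)] r sQ by simp
  have QR: "Q \<subseteq> R"
  proof (rule ccontr)
    assume nQR: "\<not> Q \<subseteq> R"
    then have RQ: "R \<subseteq> Q" using n[OF Q R(2)] R(1) aQ by auto
    then have "?r \<le> ?l" using cube_subset_imp_le[of b ?r a ?l] pos R(3) Qa by simp
    moreover have "?l \<le> ?r" unfolding r using pos(1) mult_right_mono[of 1 "2 ^ m" ?l] by simp
    ultimately have eq: "?r = ?l" by simp
    have "disjoint {Q \<in> D. \<exists>a. Q = cube a ?l}" using p[of k] by (simp add: partition_on_def)
    moreover have "Q \<in> {Q \<in> D. \<exists>a. Q = cube a ?l}" "R \<in> {Q \<in> D. \<exists>a. Q = cube a ?l}"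
      using Q R Qa eq by auto
    ultimately have "Q = R" using aQ R(1) by (meson disjointD disjoint_iff)
    then show False using nQR by simp
  qed
  show ?thesis
  proof (rule ex1I[of _ R])
    show "R \<in> D \<and> Q \<subseteq> R \<and> side_length R = 2 ^ m * side_length Q" using R QR sR by simp
    fix T assume T: "T \<in> D \<and> Q \<subseteq> T \<and> side_length T = 2 ^ m * side_length Q"
    obtain e and j :: int where e: "T = cube e (l0 * 2 powi j)" using c T by blast
    have "side_length T = l0 * 2 powi j" using e side_length_cube[of "l0 * 2 powi j" e] l0 by simp
    then have "l0 * 2 powi j = ?r" using T sQ r by metis
    then have "T \<in> {Q \<in> D. \<exists>a. Q = cube a ?r}" "R \<in> {Q \<in> D. \<exists>a. Q = cube a ?r}"
      using T e R by auto
    moreover have "disjoint {Q \<in> D. \<exists>a. Q = cube a ?r}"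
      using p[of "k + int m"] by (simp add: partition_on_def)
    moreover have "a \<in> T" using T aQ by blast
    ultimately show "T = R" using R(1) by (meson disjointD disjoint_iff)
  qed
qed

end

(* Principal cubes: the children of a cube R are the maximal dyadic cubes Q inside R such that
   the average of f over Q exceeds 4 times that over R, or at least 8 cubes of S lie between
   Q and R. Either condition holds on at most a quarter of R, so the family S' generated
   from P is 1/2-sparse. Charge Q in S to the smallest R in S' containing the m-th parent of Q;
   then the average over that parent is at most 4 times the average over R. Of the cubes
   through x charged to R, at most 7 are not stopped, and any other lies below a child T of R
   that its m-th parent strictly contains, which leaves m scales. *)
theory Submission
  imports Defs
begin

section \<open>Dyadic lattices\<close>

lemma cube_borel: "cube a l \<in> sets borel"
proof -
  have "cube a l = {x. \<forall>i. a $ i \<le> x $ i} \<inter> {x. \<forall>i. x $ i < a $ i + l}"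
    by (auto simp: cube_def)
  then show ?thesis by simp
qed

lemma bounded_cube: "bounded (cube a l)"
proof -
  have "cube a l \<subseteq> cbox a (\<chi> i. a $ i + l)"
    by (auto simp: cube_def mem_box_cart less_imp_le)
  then show ?thesis using bounded_cbox bounded_subset by blast
qed

lemma lmeasurable_cube: "cube a l \<in> lmeasurable"
  by (intro bounded_set_imp_lmeasurable bounded_cube)
     (metis cube_borel sets_completionI_sets sets_lborel)

text \<open>The open box with the same corners sits inside the cube. Positivity of the measure and
  countability of the lattice both rest on this.\<close>

lemma interior_cube_nonempty:
  assumes "l > 0"
  shows "interior (cube a l) \<noteq> {}"
proof -
  have "box a (\<chi> i. a $ i + l) \<subseteq> cube a l"
    by (auto simp: cube_def mem_box_cart less_imp_le)
  then have "box a (\<chi> i. a $ i + l) \<subseteq> interior (cube a l)"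
    by (rule interior_maximal) (rule open_box)
  moreover have "(\<chi> i. a $ i + l / 2) \<in> box a (\<chi> i. a $ i + l)"
    using assms by (simp add: mem_box_cart)
  ultimately show ?thesis by blast
qed

lemma measure_cube_pos:
  assumes "l > 0"
  shows "measure lebesgue (cube a l) > 0"
proof -
  have "\<not> negligible (interior (cube a l))"
    using interior_cube_nonempty[OF assms] open_not_negligible by blast
  then have "\<not> negligible (cube a l)"
    using interior_subset negligible_subset by blast
  then show ?thesis
    using negligible_iff_measure0[OF lmeasurable_cube]
    by (metis measure_nonneg order_le_less)
qed

lemma two_powi_less_iff: "(2::real) powi j < 2 powi k \<longleftrightarrow> j < k"
  using power_int_strict_increasing[of j k "2::real"] power_int_increasing[of k j "2::real"]
  by (cases "j < k") auto

lemma two_powi_le_iff: "(2::real) powi j \<le> 2 powi k \<longleftrightarrow> j \<le> k"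
  using two_powi_less_iff[of k j] by (simp add: linorder_not_less[symmetric] del: not_less)

section \<open>Nesting, scales and countability in a dyadic lattice\<close>

locale dyadic_lattice =
  fixes D :: "(real ^ 'n) set set"
  assumes grid: "dyadic_grid D"
begin

lemma dyadic_cubeE:
  assumes "Q \<in> D"
  obtains a l where "l > 0" "Q = cube a l"
  using grid assms unfolding dyadic_grid_def
  by (metis mult_pos_pos zero_less_numeral zero_less_power_int)

lemma lmeasurable: "Q \<in> D \<Longrightarrow> Q \<in> lmeasurable"
  by (metis dyadic_cubeE lmeasurable_cube)

lemma sets_lebesgue: "Q \<in> D \<Longrightarrow> Q \<in> sets lebesgue"
  using lmeasurable by blast

lemma measure_pos: "Q \<in> D \<Longrightarrow> measure lebesgue Q > 0"
  by (metis dyadic_cubeE measure_cube_pos)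

lemma emeasure_eq_measure: "Q \<in> D \<Longrightarrow> emeasure lebesgue Q = ennreal (measure lebesgue Q)"
  using lmeasurable by (simp add: emeasure_eq_measure2)

lemma nonempty: "Q \<in> D \<Longrightarrow> Q \<noteq> {}"
  using measure_pos by fastforce

lemma nested:
  assumes "Q \<in> D" "R \<in> D" "x \<in> Q" "x \<in> R"
  shows "Q \<subseteq> R \<or> R \<subseteq> Q"
proof -
  have "Q \<inter> R \<in> {{}, Q, R}"
    using grid assms unfolding dyadic_grid_def by blast
  then show ?thesis using assms by blast
qed

lemma side_length_mono:
  assumes "Q \<in> D" "R \<in> D" "Q \<subseteq> R"
  shows "side_length Q \<le> side_length R"
  by (metis assms cube_subset_imp_le dyadic_cubeE side_length_cube)

lemma eq_if_side_length_eq: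
  assumes "Q \<in> D" "R \<in> D" "x \<in> Q" "x \<in> R" "side_length Q = side_length R"
  shows "Q = R"
proof -
  \<comment> \<open>Both \<open>A\<close> and \<open>B\<close> qualify as the zeroth parent of
    \<open>A\<close>, which is unique.\<close>
  have "A = B" if "A \<in> D" "B \<in> D" "A \<subseteq> B" "side_length A = side_length B" for A B
    using dyadic_parent_ex1[OF grid that(1), of 0] that by auto
  then show ?thesis using nested[OF assms(1-4)] assms by metis
qed

lemma side_length_strict_mono:
  assumes "Q \<in> D" "R \<in> D" "Q \<subset> R"
  shows "side_length Q < side_length R"
  using assms eq_if_side_length_eq side_length_mono nonempty
  by (metis all_not_in_conv order_le_less psubset_eq subsetD)

text \<open>Integer generations turn statements about scales into counting in integer
  intervals.\<close>

lemma generationE: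
  obtains l0 :: real and g :: "(real ^ 'n) set \<Rightarrow> int"
  where "l0 > 0" "\<And>Q. Q \<in> D \<Longrightarrow> side_length Q = l0 * 2 powi g Q"
proof -
  obtain l0 where l0: "l0 > 0"
    and c: "\<And>Q. Q \<in> D \<Longrightarrow> \<exists>a. \<exists>k::int. Q = cube a (l0 * 2 powi k)"
    using grid unfolding dyadic_grid_def by auto
  from c have "\<forall>Q. \<exists>k::int. Q \<in> D \<longrightarrow> (\<exists>a. Q = cube a (l0 * 2 powi k))" by blast
  then obtain g :: "(real ^ 'n) set \<Rightarrow> int"
    where g: "\<And>Q. Q \<in> D \<Longrightarrow> \<exists>a. Q = cube a (l0 * 2 powi g Q)" by metis
  have "side_length Q = l0 * 2 powi g Q" if "Q \<in> D" for Q
    using g[OF that] side_length_cube l0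
    by (metis mult_pos_pos zero_less_numeral zero_less_power_int)
  with that l0 g show thesis by blast
qed

text \<open>All these cubes share a point of \<open>Q\<close>, so each is determined by its
  generation, an integer between those of \<open>Q\<close> and \<open>R\<close>. This finiteness
  yields maximal stopped cubes and smallest principal cubes.\<close>

lemma finite_chain:
  assumes "Q \<in> D" "R \<in> D"
  shows "finite {T \<in> D. Q \<subseteq> T \<and> T \<subseteq> R}"
proof -
  obtain l0 :: real and g :: "(real ^ 'n) set \<Rightarrow> int" where l0: "l0 > 0"
    and g: "\<And>Q. Q \<in> D \<Longrightarrow> side_length Q = l0 * 2 powi g Q"
    by (rule generationE) blast
  have mono: "g A \<le> g B" if "A \<in> D" "B \<in> D" "A \<subseteq> B" for A B
    using side_length_mono[OF that] g[OF that(1)] g[OF that(2)] l0 by (simp add: two_powi_le_iff)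
  obtain x where x: "x \<in> Q" using nonempty[OF assms(1)] by blast
  have "inj_on g {T \<in> D. Q \<subseteq> T \<and> T \<subseteq> R}"
  proof (rule inj_onI)
    fix A B assume "A \<in> {T \<in> D. Q \<subseteq> T \<and> T \<subseteq> R}" "B \<in> {T \<in> D. Q \<subseteq> T \<and> T \<subseteq> R}" "g A = g B"
    then show "A = B" using x eq_if_side_length_eq[of A B x] g[of A] g[of B] by auto
  qed
  moreover have "g ` {T \<in> D. Q \<subseteq> T \<and> T \<subseteq> R} \<subseteq> {g Q..g R}"
    using mono assms by auto
  ultimately show ?thesis
    by (meson finite_atLeastAtMost_int inj_on_finite)
qed

text \<open>Cubes through one point have distinct generations, and the two bounds on the side length
  leave exactly \<open>m\<close> possible integers.\<close>

lemma card_scales_le: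
  assumes "C \<subseteq> D" and x: "\<And>Q. Q \<in> C \<Longrightarrow> x \<in> Q"
    and scale: "\<And>Q. Q \<in> C \<Longrightarrow> side_length Q \<le> side_length R \<and> side_length R < 2 ^ m * side_length Q"
    and "R \<in> D"
  shows "card C \<le> m"
proof -
  obtain l0 :: real and g :: "(real ^ 'n) set \<Rightarrow> int" where l0: "l0 > 0"
    and g: "\<And>Q. Q \<in> D \<Longrightarrow> side_length Q = l0 * 2 powi g Q"
    by (rule generationE) blast
  have "inj_on g C"
  proof (rule inj_onI)
    fix A B assume "A \<in> C" "B \<in> C" "g A = g B"
    then show "A = B" using assms(1) x eq_if_side_length_eq[of A B x] g[of A] g[of B] by auto
  qed
  moreover have "g ` C \<subseteq> {g R - int m<..g R}"
  proof (rule image_subsetI)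
    fix Q assume Q: "Q \<in> C"
    then have QD: "Q \<in> D" using assms(1) by blast
    have "(2::real) powi g R < 2 powi (g Q + int m)" "(2::real) powi g Q \<le> 2 powi g R"
      using scale[OF Q] g[OF QD] g[OF assms(4)] l0 by (simp_all add: power_int_add mult.commute)
    then have "g R < g Q + int m" "g Q \<le> g R"
      by (simp_all only: two_powi_less_iff two_powi_le_iff)
    then show "g Q \<in> {g R - int m<..g R}" by simp
  qed
  ultimately have "card C \<le> card {g R - int m<..g R}"
    by (meson card_inj_on_le finite_greaterThanAtMost_int)
  then show ?thesis by simp
qed

text \<open>Each generation is a disjoint family of sets with nonempty interior, hence countable,
  and the generations are indexed by integers.\<close>

lemma countable_dyadic: "countable D"
proof -
  obtain l0 :: real and g :: "(real ^ 'n) set \<Rightarrow> int" where l0: "l0 > 0"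
    and g: "\<And>Q. Q \<in> D \<Longrightarrow> side_length Q = l0 * 2 powi g Q"
    by (rule generationE) blast
  have "countable {Q \<in> D. g Q = k}" for k
  proof (rule countable_disjoint_nonempty_interior_subsets)
    show "disjoint {Q \<in> D. g Q = k}"
    proof (rule disjointI)
      fix Q R assume "Q \<in> {Q \<in> D. g Q = k}" "R \<in> {Q \<in> D. g Q = k}" "Q \<noteq> R"
      then show "Q \<inter> R = {}"
        using eq_if_side_length_eq[of Q R] g[of Q] g[of R] by auto
    qed
    fix Q assume "Q \<in> {Q \<in> D. g Q = k}" and empty: "interior Q = {}"
    then obtain a l where "l > 0" "Q = cube a l" using dyadic_cubeE[of Q] by blast
    then show "Q = {}" using empty interior_cube_nonempty[of l a] by simp
  qed
  then have "countable (\<Union>k. {Q \<in> D. g Q = k})" by blast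
  moreover have "D = (\<Union>k. {Q \<in> D. g Q = k})" by auto
  ultimately show ?thesis by simp
qed

section \<open>Maximal cubes of a family below a fixed cube\<close>

definition maximal :: "(real ^ 'n) set set \<Rightarrow> (real ^ 'n) set set" where
  "maximal A = {Q \<in> A. \<forall>T\<in>A. Q \<subseteq> T \<longrightarrow> Q = T}"

lemma maximal_subset: "maximal A \<subseteq> A"
  by (auto simp: maximal_def)

lemma maximalD: "Q \<in> maximal A \<Longrightarrow> T \<in> A \<Longrightarrow> Q \<subseteq> T \<Longrightarrow> Q = T"
  by (auto simp: maximal_def)

text \<open>The cubes of \<open>A\<close> above \<open>Q\<close> belong to the finite chain from
  \<open>Q\<close> to \<open>R\<close>; without an enclosing cube an ascending chain might never
  end.\<close>

lemma maximal_above: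
  assumes "R \<in> D" "A \<subseteq> {Q \<in> D. Q \<subseteq> R}" "Q \<in> A"
  obtains T where "T \<in> maximal A" "Q \<subseteq> T"
proof -
  have "finite {T \<in> A. Q \<subseteq> T}"
    by (rule finite_subset[OF _ finite_chain[of Q R]]) (use assms in auto)
  then obtain T where T: "T \<in> A" "Q \<subseteq> T" "\<And>T'. T' \<in> A \<Longrightarrow> Q \<subseteq> T' \<Longrightarrow> T \<subseteq> T' \<Longrightarrow> T = T'"
    using finite_has_maximal2[of "{T \<in> A. Q \<subseteq> T}" Q] assms(3) by auto
  then have "T \<in> maximal A" unfolding maximal_def by auto
  with T that show thesis by blast
qed

lemma Union_maximal:
  assumes "R \<in> D" "A \<subseteq> {Q \<in> D. Q \<subseteq> R}"
  shows "\<Union>(maximal A) = \<Union>A"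
proof
  show "\<Union>(maximal A) \<subseteq> \<Union>A" using maximal_subset by blast
  show "\<Union>A \<subseteq> \<Union>(maximal A)" by (meson Union_least Union_upper maximal_above[OF assms] order_trans)
qed

lemma disjoint_maximal:
  assumes "A \<subseteq> D"
  shows "disjoint (maximal A)"
proof (rule disjointI)
  fix Q R assume "Q \<in> maximal A" "R \<in> maximal A" "Q \<noteq> R"
  then show "Q \<inter> R = {}"
    using nested[of Q R] assms unfolding maximal_def by blast
qed

section \<open>Measure estimates for unions of subcubes\<close>

lemma sets_Union: "A \<subseteq> D \<Longrightarrow> \<Union>A \<in> sets lebesgue"
  using countable_dyadic sets_lebesgue by (meson countable_subset sets.countable_Union subset_eq)

text \<open>Overlaps in \<open>A\<close> disappear on passing to its maximal cubes, which are
  countable, disjoint and have the same union; the bound then sums. The intended \<open>N\<close> is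
  \<open>f\<close> times Lebesgue measure.\<close>

lemma Union_measure_le:
  assumes "R \<in> D" "A \<subseteq> {Q \<in> D. Q \<subseteq> R}" and sets: "sets N = sets lebesgue"
    and le: "\<And>Q. Q \<in> A \<Longrightarrow> c * emeasure lebesgue Q \<le> emeasure N Q"
  shows "c * emeasure lebesgue (\<Union>A) \<le> emeasure N R"
proof -
  let ?M = "maximal A"
  have MA: "?M \<subseteq> A" by (rule maximal_subset)
  then have MD: "?M \<subseteq> D" using assms by blast
  have cnt: "countable ?M" using MD countable_dyadic countable_subset by blast
  have disj: "disjoint_family_on (\<lambda>Q. Q) ?M"
    using disjoint_maximal[of A] assms(2)
    by (auto simp: disjoint_family_on_def disjoint_def)
  have UN: "emeasure K (\<Union>A) = (\<integral>\<^sup>+Q. emeasure K Q \<partial>count_space ?M)"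
    if "sets K = sets lebesgue" for K
    using emeasure_UN_countable[of ?M "\<lambda>Q. Q" K, OF _ cnt disj] MD sets_lebesgue that
      Union_maximal[OF assms(1,2)] by auto
  have "c * emeasure lebesgue (\<Union>A) = (\<integral>\<^sup>+Q. c * emeasure lebesgue Q \<partial>count_space ?M)"
    by (subst UN) (simp_all add: nn_integral_cmult)
  also have "\<dots> \<le> (\<integral>\<^sup>+Q. emeasure N Q \<partial>count_space ?M)"
    by (rule nn_integral_mono) (use MA le in auto)
  also have "\<dots> = emeasure N (\<Union>A)" by (simp add: UN sets)
  also have "\<dots> \<le> emeasure N R"
    by (rule emeasure_mono) (use assms(1,2) sets_lebesgue sets in auto)
  finally show ?thesis .
qed

lemma lmeasurable_Union:
  assumes "R \<in> D" "A \<subseteq> {Q \<in> D. Q \<subseteq> R}"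
  shows "\<Union>A \<in> lmeasurable"
proof (rule fmeasurableI2[OF lmeasurable[OF assms(1)]])
  show "\<Union>A \<subseteq> R" "\<Union>A \<in> sets lebesgue"
    using sets_Union[of A] assms(2) by blast+
qed

lemma average_nonneg:
  assumes "\<And>x. x \<in> Q \<Longrightarrow> f x \<ge> 0"
  shows "average f Q \<ge> 0"
  unfolding average_def set_lebesgue_integral_def
  by (intro divide_nonneg_nonneg Bochner_Integration.integral_nonneg measure_nonneg)
     (auto simp: indicator_def assms)

text \<open>This is the weak type (1,1) bound for the dyadic maximal function, localised to
  \<open>R\<close>. With \<open>t = average f R\<close>, each cube of \<open>A\<close> has
  \<open>f\<close>-mass at least \<open>c * t\<close> times its volume, while \<open>R\<close> has
  mass \<open>t\<close> times its volume; then \<open>t\<close> cancels.\<close>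

lemma measure_Union_average_gt:
  assumes R: "R \<in> D" and A: "A \<subseteq> {Q \<in> D. Q \<subseteq> R}"
    and int: "set_integrable lebesgue R f" and nonneg: "\<And>x. x \<in> R \<Longrightarrow> f x \<ge> 0"
    and gt: "\<And>Q. Q \<in> A \<Longrightarrow> c * average f R < average f Q" and c: "c \<ge> 0"
  shows "c * measure lebesgue (\<Union>A) \<le> measure lebesgue R"
proof (cases "A = {}")
  case False
  define N where "N = density lebesgue (\<lambda>x. ennreal (indicator R x *\<^sub>R f x))"
  have meas: "(\<lambda>x. indicator R x *\<^sub>R f x) \<in> borel_measurable lebesgue"
    using int unfolding set_integrable_def by blast
  have sets_N: "sets N = sets lebesgue" by (simp add: N_def)
  have N: "emeasure N Q = ennreal (average f Q * measure lebesgue Q)" if Q: "Q \<in> D" "Q \<subseteq> R" for Q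
  proof -
    have "emeasure N Q = (\<integral>\<^sup>+x. ennreal (indicator R x *\<^sub>R f x) * indicator Q x \<partial>lebesgue)"
      unfolding N_def using meas sets_lebesgue[OF Q(1)] by (subst emeasure_density) auto
    also have "\<dots> = (\<integral>\<^sup>+x. ennreal (indicator Q x *\<^sub>R f x) \<partial>lebesgue)"
      using Q(2) by (intro nn_integral_cong) (auto simp: indicator_def)
    also have "\<dots> = ennreal (LINT x:Q|lebesgue. f x)"
      unfolding set_lebesgue_integral_def
    proof (rule nn_integral_eq_integral)
      show "integrable lebesgue (\<lambda>x. indicator Q x *\<^sub>R f x)"
        using set_integrable_subset[OF int sets_lebesgue[OF Q(1)] Q(2)]
        unfolding set_integrable_def .
      show "AE x in lebesgue. 0 \<le> indicator Q x *\<^sub>R f x"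
        using nonneg Q(2) by (auto simp: indicator_def)
    qed
    also have "(LINT x:Q|lebesgue. f x) = average f Q * measure lebesgue Q"
      using measure_pos[OF Q(1)] by (simp add: average_def)
    finally show ?thesis .
  qed
  define t where "t = average f R"
  have t: "t \<ge> 0" unfolding t_def using nonneg by (rule average_nonneg)
  have UL: "\<Union>A \<in> lmeasurable" by (rule lmeasurable_Union[OF R A])
  have "ennreal (c * t) * emeasure lebesgue (\<Union>A) \<le> emeasure N R"
  proof (rule Union_measure_le[OF R A sets_N])
    fix Q assume "Q \<in> A"
    then have Q: "Q \<in> D" "Q \<subseteq> R" "c * t < average f Q" using A gt by (auto simp: t_def)
    show "ennreal (c * t) * emeasure lebesgue Q \<le> emeasure N Q"
      unfolding N[OF Q(1,2)] emeasure_eq_measure[OF Q(1)]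
      using Q(3) c t by (simp flip: ennreal_mult add: ennreal_leI mult_right_mono)
  qed
  then have "c * t * measure lebesgue (\<Union>A) \<le> t * measure lebesgue R"
    unfolding N[OF R order_refl] t_def[symmetric] emeasure_eq_measure2[OF UL]
    using c t by (simp flip: ennreal_mult)
  \<comment> \<open>Cancelling needs \<open>t\<close> positive. If \<open>t\<close> vanished,
    \<open>R\<close> would carry no \<open>f\<close>-mass, yet a cube of the nonempty family
    \<open>A\<close> would have a positive average.\<close>
  moreover have "t > 0"
  proof (rule ccontr)
    assume "\<not> t > 0"
    then have "emeasure N R = 0" using N[OF R order_refl] t by (simp add: t_def)
    moreover obtain Q where "Q \<in> A" using False by blast
    then have Q: "Q \<in> D" "Q \<subseteq> R" "c * t < average f Q" using A gt by (auto simp: t_def)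
    have "emeasure N Q \<le> emeasure N R"
      by (rule emeasure_mono) (use Q sets_N sets_lebesgue[OF R] in auto)
    ultimately have "average f Q * measure lebesgue Q \<le> 0"
      using N[OF Q(1,2)] by (simp add: ennreal_eq_0_iff)
    then have "average f Q \<le> 0" using measure_pos[OF Q(1)] by (simp add: mult_le_0_iff)
    moreover have "c * t \<ge> 0" using c t by simp
    ultimately show False using Q(3) by linarith
  qed
  ultimately show ?thesis by (simp add: mult.assoc mult.left_commute[of c])
qed (simp add: measure_nonneg)

text \<open>A Carleson packing argument: integrating the number of cubes of \<open>S\<close> inside
  \<open>R\<close> through a point gives their total volume, which is at most twice that of their
  disjoint sets \<open>E\<close>, all inside \<open>R\<close>.\<close>

lemma measure_Union_crowded:
  assumes R: "R \<in> D" and A: "A \<subseteq> {Q \<in> D. Q \<subseteq> R}" and S: "S \<subseteq> D" "sparse_collection S"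
    and crowd: "\<And>Q. Q \<in> A \<Longrightarrow> k \<le> card {T \<in> S. Q \<subseteq> T \<and> T \<subseteq> R}"
  shows "real k * measure lebesgue (\<Union>A) \<le> 2 * measure lebesgue R"
proof -
  obtain E where E: "\<And>Q. Q \<in> S \<Longrightarrow> E Q \<in> sets lebesgue" "\<And>Q. Q \<in> S \<Longrightarrow> E Q \<subseteq> Q"
      "\<And>Q. Q \<in> S \<Longrightarrow> measure lebesgue (E Q) \<ge> 1 / 2 * measure lebesgue Q"
    and disj: "disjoint_family_on E S"
    using S(2) unfolding eta_sparse_def by blast
  define SR where "SR = {T \<in> S. T \<subseteq> R}"
  have SR: "SR \<subseteq> S" by (auto simp: SR_def)
  then have SRD: "SR \<subseteq> D" using S by blast
  have cnt: "countable SR" using SRD countable_dyadic countable_subset by blast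
  have UL: "\<Union>A \<in> lmeasurable" by (rule lmeasurable_Union[OF R A])
  \<comment> \<open>One \<open>Q\<close> in \<open>A\<close> through \<open>x\<close> suffices,
    since the cubes of \<open>S\<close> between \<open>Q\<close> and \<open>R\<close> all contain
    \<open>x\<close>.\<close>
  have count: "of_nat k * indicator (\<Union>A) x \<le> (\<integral>\<^sup>+T. indicator T x \<partial>count_space SR)" for x
  proof (cases "x \<in> \<Union>A")
    case True
    then obtain Q where Q: "Q \<in> A" "x \<in> Q" by blast
    let ?K = "{T \<in> S. Q \<subseteq> T \<and> T \<subseteq> R}"
    have fin: "finite ?K"
      by (rule finite_subset[OF _ finite_chain[of Q R]]) (use Q A R S in auto)
    have "of_nat k \<le> (of_nat (card ?K) :: ennreal)" using crowd[OF Q(1)] by simp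
    also have "\<dots> = (\<integral>\<^sup>+T. indicator ?K T \<partial>count_space SR)"
      using fin by (subst nn_integral_indicator) (auto simp: SR_def intro!: emeasure_count_space_finite[symmetric])
    also have "\<dots> \<le> (\<integral>\<^sup>+T. indicator T x \<partial>count_space SR)"
      using Q by (intro nn_integral_mono) (auto simp: indicator_def)
    finally show ?thesis using True by simp
  qed simp
  have "of_nat k * emeasure lebesgue (\<Union>A) = (\<integral>\<^sup>+x. of_nat k * indicator (\<Union>A) x \<partial>lebesgue)"
    using UL by (subst nn_integral_cmult_indicator) auto
  also have "\<dots> \<le> (\<integral>\<^sup>+x. (\<integral>\<^sup>+T. indicator T x \<partial>count_space SR) \<partial>lebesgue)"
    by (rule nn_integral_mono) (rule count)
  \<comment> \<open>Tonelli's theorem for a countable sum.\<close>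
  also have "\<dots> = (\<integral>\<^sup>+T. (\<integral>\<^sup>+x. indicator T x \<partial>lebesgue) \<partial>count_space SR)"
    by (rule nn_integral_count_space_nn_integral[OF cnt]) (use SRD sets_lebesgue in auto)
  also have "\<dots> \<le> (\<integral>\<^sup>+T. 2 * emeasure lebesgue (E T) \<partial>count_space SR)"
  proof (rule nn_integral_mono)
    fix T assume "T \<in> space (count_space SR)"
    then have T: "T \<in> S" "T \<in> D" using SR SRD by auto
    have "E T \<in> lmeasurable"
      by (rule fmeasurableI2[OF lmeasurable[OF T(2)] E(2,1)]) (use T in auto)
    then show "(\<integral>\<^sup>+x. indicator T x \<partial>lebesgue) \<le> 2 * emeasure lebesgue (E T)"
      using E(3)[OF T(1)] emeasure_eq_measure[OF T(2)] sets_lebesgue[OF T(2)]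
      by (simp add: emeasure_eq_measure2 flip: ennreal_numeral ennreal_mult)
  qed
  also have "\<dots> = 2 * emeasure lebesgue (\<Union>(E ` SR))"
    using E(1) SR disjoint_family_on_mono[OF SR disj] cnt
    by (subst emeasure_UN_countable) (auto simp: nn_integral_cmult)
  also have "\<dots> \<le> 2 * emeasure lebesgue R"
    using E(2) sets_lebesgue[OF R] by (intro mult_left_mono emeasure_mono) (auto simp: SR_def)
  finally show ?thesis
    by (simp add: emeasure_eq_measure2[OF UL] emeasure_eq_measure[OF R] ennreal_of_nat_eq_real_of_nat
        flip: ennreal_numeral ennreal_mult)
qed

lemma parent:
  assumes "Q \<in> D"
  shows "dyadic_parent D m Q \<in> D" "Q \<subseteq> dyadic_parent D m Q"
    "side_length (dyadic_parent D m Q) = 2 ^ m * side_length Q"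
  using theI'[OF dyadic_parent_ex1[OF grid assms, of m]]
  unfolding dyadic_parent_def by auto

lemma parent_0: "Q \<in> D \<Longrightarrow> dyadic_parent D 0 Q = Q"
  by (metis dyadic_parent_ex1[OF grid, of Q 0] parent[of Q 0] mult_1 order_refl power_0)

end

section \<open>Principal cubes of a stopping rule\<close>

text \<open>The rule stays abstract: strict inclusion alone drives the tree structure, and
  sparseness will ask only for a bound on the stopped volume.\<close>

locale stopping_rule = dyadic_lattice D for D :: "(real ^ 'n) set set" +
  fixes P :: "(real ^ 'n) set" and stop :: "(real ^ 'n) set \<Rightarrow> (real ^ 'n) set set"
  assumes P: "P \<in> D" and stop: "\<And>R. stop R \<subseteq> {Q \<in> D. Q \<subset> R}"
begin

inductive_set principal :: "(real ^ 'n) set set" where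
  top: "P \<in> principal"
| child: "R \<in> principal \<Longrightarrow> Q \<in> maximal (stop R) \<Longrightarrow> Q \<in> principal"

lemma children: "Q \<in> maximal (stop R) \<Longrightarrow> Q \<in> D \<and> Q \<subset> R"
  using stop maximal_subset by blast

lemma principal_dyadic: "R \<in> principal \<Longrightarrow> R \<in> D \<and> R \<subseteq> P"
  by (induction rule: principal.induct) (use P children in blast)+

lemma stop_below_child:
  assumes "R \<in> D" "Q \<in> stop R"
  obtains T where "T \<in> maximal (stop R)" "Q \<subseteq> T"
  by (rule maximal_above[of R "stop R" Q]) (use assms stop in auto)

text \<open>This is the source of disjointness for the sparse sets. The cube \<open>R'\<close> is a
  child of some \<open>B\<close>, and nesting allows \<open>R\<close> to be compared with
  \<open>B\<close>.\<close>

lemma principal_below_child: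
  assumes "R' \<in> principal" "R \<in> principal" "R' \<subset> R"
  shows "\<exists>T\<in>maximal (stop R). R' \<subseteq> T"
  using assms
\<comment> \<open>The measure is the depth of \<open>R'\<close> below \<open>P\<close>; it drops
  whenever \<open>R'\<close> is replaced by a strictly larger principal cube.\<close>
proof (induction "card {T \<in> D. R' \<subseteq> T \<and> T \<subseteq> P}" arbitrary: R R' rule: less_induct)
  case less
  have smaller: "card {T \<in> D. B \<subseteq> T \<and> T \<subseteq> P} < card {T \<in> D. R' \<subseteq> T \<and> T \<subseteq> P}"
    if "B \<in> principal" "R' \<subset> B" for B
  proof (rule psubset_card_mono)
    show "finite {T \<in> D. R' \<subseteq> T \<and> T \<subseteq> P}"
      using finite_chain P principal_dyadic less.prems by blast
    show "{T \<in> D. B \<subseteq> T \<and> T \<subseteq> P} \<subset> {T \<in> D. R' \<subseteq> T \<and> T \<subseteq> P}"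
      using that principal_dyadic less.prems by blast
  qed
  from less.prems(1) show ?case
  proof cases
    case top
    then show ?thesis using less.prems principal_dyadic by blast
  next
    case (child B)
    have R'B: "R' \<subset> B" using child children by blast
    have R'D: "R' \<in> D" using less.prems principal_dyadic by blast
    obtain x where x: "x \<in> R'" using nonempty[OF R'D] by blast
    consider "R = B" | "B \<subset> R" | "R \<subset> B"
      using nested[of B R x] principal_dyadic child(1) less.prems x R'B by blast
    then show ?thesis
    proof cases
      case 1
      then show ?thesis using child by blast
    next
      case 2
      then show ?thesis
        using less.hyps[OF smaller[OF child(1) R'B] child(1) less.prems(2)] R'B by blast
    next
      \<comment> \<open>Here \<open>R'\<close> would lie strictly inside \<open>T\<close>, which is
        stopped under \<open>B\<close> as well, against the maximality of \<open>R'\<close>.\<close>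
      case 3
      then obtain T where T: "T \<in> maximal (stop B)" "R \<subseteq> T"
        using less.hyps[OF smaller[OF less.prems(2,3)] less.prems(2) child(1)] by blast
      then have "R' \<subset> T" using less.prems(3) by blast
      moreover have "T \<in> stop B" using T(1) maximal_subset by blast
      ultimately show ?thesis
        using maximalD[OF child(2), of T] by blast
    qed
  qed
qed

text \<open>The sparse set of \<open>R\<close> is what remains after removing its stopped cubes. A
  strictly smaller principal cube inside \<open>R\<close> lies wholly in the removed part.\<close>

lemma sparse_principal:
  assumes half: "\<And>R. R \<in> D \<Longrightarrow> R \<subseteq> P \<Longrightarrow>
    2 * measure lebesgue (\<Union>(stop R)) \<le> measure lebesgue R"
  shows "sparse_collection principal"
  unfolding eta_sparse_def
proof (intro exI[of _ "\<lambda>R. R - \<Union>(stop R)"] conjI ballI)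
  fix R assume R: "R \<in> principal"
  then have RD: "R \<in> D" and RP: "R \<subseteq> P" using principal_dyadic by auto
  have "stop R \<subseteq> D" using stop[of R] by blast
  then have U: "\<Union>(stop R) \<in> sets lebesgue" "\<Union>(stop R) \<subseteq> R"
    using sets_Union stop[of R] by (blast, fast)
  show "R - \<Union>(stop R) \<in> sets lebesgue" using U sets_lebesgue[OF RD] by blast
  show "R - \<Union>(stop R) \<subseteq> R" by blast
  show "1 / 2 * measure lebesgue R \<le> measure lebesgue (R - \<Union>(stop R))"
    using half[OF RD RP] measurable_measure_Diff[OF lmeasurable[OF RD] U(1,2)] by simp
next
  show "disjoint_family_on (\<lambda>R. R - \<Union>(stop R)) principal"
    unfolding disjoint_family_on_def
  proof (intro ballI impI)
    fix R R' assume *: "R \<in> principal" "R' \<in> principal" "R \<noteq> R'"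
    have "A \<subseteq> \<Union>(stop B)" if "A \<in> principal" "B \<in> principal" "A \<subset> B" for A B
      using principal_below_child[OF that] maximal_subset by blast
    moreover have "R \<subset> R' \<or> R' \<subset> R \<or> R \<inter> R' = {}"
      using nested[of R R'] principal_dyadic * by blast
    ultimately show "(R - \<Union>(stop R)) \<inter> (R' - \<Union>(stop R')) = {}"
      using * by blast
  qed
qed

section \<open>The smallest principal cube containing a given cube\<close>

definition stopping_parent :: "(real ^ 'n) set \<Rightarrow> (real ^ 'n) set" where
  "stopping_parent Q = (SOME R. R \<in> principal \<and> Q \<subseteq> R \<and>
     (\<forall>T\<in>principal. Q \<subseteq> T \<longrightarrow> T \<subseteq> R \<longrightarrow> T = R))"

text \<open>The chain from \<open>Q\<close> to \<open>P\<close> is finite and \<open>P\<close> is a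
  candidate, so a minimal choice exists. Principal cubes containing \<open>Q\<close> are nested,
  hence minimal means smallest.\<close>

lemma stopping_parent:
  assumes "Q \<in> D" "Q \<subseteq> P"
  shows "stopping_parent Q \<in> principal" "Q \<subseteq> stopping_parent Q"
    "\<And>T. T \<in> principal \<Longrightarrow> Q \<subseteq> T \<Longrightarrow> T \<subseteq> stopping_parent Q \<Longrightarrow> T = stopping_parent Q"
proof -
  have "finite {R \<in> principal. Q \<subseteq> R}"
    by (rule finite_subset[OF _ finite_chain[of Q P]]) (use assms P principal_dyadic in auto)
  moreover have "P \<in> {R \<in> principal. Q \<subseteq> R}" using assms top by simp
  ultimately obtain R where R: "R \<in> {R \<in> principal. Q \<subseteq> R}"
    "\<forall>T\<in>{R \<in> principal. Q \<subseteq> R}. T \<subseteq> R \<longrightarrow> R = T"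
    by (meson finite_has_minimal2)
  then have "R \<in> principal \<and> Q \<subseteq> R \<and> (\<forall>T\<in>principal. Q \<subseteq> T \<longrightarrow> T \<subseteq> R \<longrightarrow> T = R)"
    by blast
  then have "stopping_parent Q \<in> principal \<and> Q \<subseteq> stopping_parent Q \<and>
     (\<forall>T\<in>principal. Q \<subseteq> T \<longrightarrow> T \<subseteq> stopping_parent Q \<longrightarrow> T = stopping_parent Q)"
    unfolding stopping_parent_def by (rule someI)
  then show "stopping_parent Q \<in> principal" "Q \<subseteq> stopping_parent Q"
    "\<And>T. T \<in> principal \<Longrightarrow> Q \<subseteq> T \<Longrightarrow> T \<subseteq> stopping_parent Q \<Longrightarrow> T = stopping_parent Q"
    by auto
qed

text \<open>Such a \<open>T\<close> would be a principal cube containing \<open>Q\<close> and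
  strictly smaller than its stopping parent.\<close>

lemma not_below_child_of_stopping_parent:
  assumes "Q \<in> D" "Q \<subseteq> P" "T \<in> maximal (stop (stopping_parent Q))"
  shows "\<not> Q \<subseteq> T"
proof
  assume "Q \<subseteq> T"
  moreover have "T \<in> principal"
    using stopping_parent(1)[OF assms(1,2)] assms(3) by (rule principal.child)
  ultimately have "T = stopping_parent Q"
    using stopping_parent(3)[OF assms(1,2)] children[OF assms(3)] by blast
  then show False using children[OF assms(3)] by blast
qed

text \<open>Every stopped cube lies below a child. Hence a cube strictly inside its stopping parent
  fails every stopping condition.\<close>

lemma not_stop_stopping_parent:
  assumes "Q \<in> D" "Q \<subseteq> P"
  shows "Q \<notin> stop (stopping_parent Q)"
proof
  assume "Q \<in> stop (stopping_parent Q)"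
  moreover have "stopping_parent Q \<in> D"
    using stopping_parent(1)[OF assms] principal_dyadic by blast
  ultimately obtain T where "T \<in> maximal (stop (stopping_parent Q))" "Q \<subseteq> T"
    using stop_below_child by blast
  then show False using not_below_child_of_stopping_parent[OF assms] by blast
qed

end

section \<open>Domination of the shift\<close>

locale sparse_shift = dyadic_lattice D for D :: "(real ^ 'n) set set" +
  fixes P :: "(real ^ 'n) set" and S :: "(real ^ 'n) set set" and f :: "real ^ 'n \<Rightarrow> real"
    and m :: nat
  assumes P: "P \<in> D" and S: "S \<subseteq> D" "sparse_collection S"
    and parent_subset: "\<And>Q. Q \<in> S \<Longrightarrow> dyadic_parent D m Q \<subseteq> P"
    and integrable: "set_integrable lebesgue P f" and nonneg: "\<And>x. x \<in> P \<Longrightarrow> f x \<ge> 0"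
begin

text \<open>The count includes \<open>Q\<close> and \<open>R\<close> themselves whenever they belong
  to \<open>S\<close>.\<close>

definition stop :: "(real ^ 'n) set \<Rightarrow> (real ^ 'n) set set" where
  "stop R = {Q \<in> D. Q \<subset> R \<and>
     (4 * average f R < average f Q \<or> 8 \<le> card {T \<in> S. Q \<subseteq> T \<and> T \<subseteq> R})}"

sublocale stopping_rule D P stop
  by unfold_locales (auto simp: P stop_def)

lemma principal_sparse: "sparse_collection principal"
proof (rule sparse_principal)
  fix R assume R: "R \<in> D" "R \<subseteq> P"
  define A where "A = {Q \<in> D. Q \<subset> R \<and> 4 * average f R < average f Q}"
  define B where "B = {Q \<in> D. Q \<subset> R \<and> 8 \<le> card {T \<in> S. Q \<subseteq> T \<and> T \<subseteq> R}}"
  have A: "A \<subseteq> {Q \<in> D. Q \<subseteq> R}" and B: "B \<subseteq> {Q \<in> D. Q \<subseteq> R}"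
    by (auto simp: A_def B_def)
  \<comment> \<open>Level 4 costs a quarter of \<open>R\<close>; below, the threshold 8 against the
    factor 2 from sparseness of \<open>S\<close> costs another quarter.\<close>
  have "4 * measure lebesgue (\<Union>A) \<le> measure lebesgue R"
    by (rule measure_Union_average_gt[OF R(1) A, of f])
       (use R nonneg set_integrable_subset[OF integrable] sets_lebesgue in \<open>auto simp: A_def\<close>)
  moreover have "real 8 * measure lebesgue (\<Union>B) \<le> 2 * measure lebesgue R"
    by (rule measure_Union_crowded[OF R(1) B S]) (auto simp: B_def)
  moreover have "measure lebesgue (\<Union>A \<union> \<Union>B) \<le> measure lebesgue (\<Union>A) + measure lebesgue (\<Union>B)"
    using lmeasurable_Union[OF R(1) A] lmeasurable_Union[OF R(1) B] by (intro measure_Un_le) auto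
  moreover have "\<Union>(stop R) = \<Union>A \<union> \<Union>B" by (auto simp: stop_def A_def B_def)
  ultimately show "2 * measure lebesgue (\<Union>(stop R)) \<le> measure lebesgue R" by simp
qed

text \<open>Grouping uses the \<open>m\<close>-th parent because its average occurs in the operator.
  Thus \<open>Q\<close> itself may lie below a child of its owner, which is where the dependence on
  \<open>m\<close> arises.\<close>

abbreviation owner :: "(real ^ 'n) set \<Rightarrow> (real ^ 'n) set" where
  "owner Q \<equiv> stopping_parent (dyadic_parent D m Q)"

lemma owner:
  assumes "Q \<in> S"
  shows "owner Q \<in> principal" "owner Q \<in> D" "owner Q \<subseteq> P" "Q \<subseteq> owner Q"
proof -
  have Q: "dyadic_parent D m Q \<in> D" "Q \<subseteq> dyadic_parent D m Q"
    using parent assms S by blast+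
  show "owner Q \<in> principal"
    by (rule stopping_parent(1)[OF Q(1) parent_subset[OF assms]])
  then show "owner Q \<in> D" "owner Q \<subseteq> P" using principal_dyadic by blast+
  show "Q \<subseteq> owner Q"
    using stopping_parent(2)[OF Q(1) parent_subset[OF assms]] Q(2) by blast
qed

text \<open>Unless it is the owner itself, the \<open>m\<close>-th parent lies strictly inside the
  owner and is not stopped, so its average cannot exceed the threshold.\<close>

lemma average_parent_le:
  assumes "Q \<in> S"
  shows "average f (dyadic_parent D m Q) \<le> 4 * average f (owner Q)"
proof (cases "dyadic_parent D m Q = owner Q")
  case True
  have "average f (owner Q) \<ge> 0"
    using owner(3)[OF assms] nonneg by (intro average_nonneg) blast
  then show ?thesis using True by simp
next
  case False
  have D: "dyadic_parent D m Q \<in> D" using parent assms S by blast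
  have "dyadic_parent D m Q \<subset> owner Q"
    using stopping_parent(2)[OF D parent_subset[OF assms]] False by blast
  then show ?thesis
    using not_stop_stopping_parent[OF D parent_subset[OF assms]] D by (auto simp: stop_def)
qed

text \<open>Cubes through \<open>x\<close> are nested, so the smallest unstopped cube
  \<open>Q0\<close> controls one part of \<open>B\<close>, with at most 7 members, and the largest
  stopped cube \<open>Q1\<close> the other, with at most \<open>m\<close>.\<close>

lemma card_owner_le:
  assumes fin: "finite B" and B: "B \<subseteq> {Q \<in> S. x \<in> Q \<and> owner Q = R}"
  shows "card B \<le> 7 + m"
proof -
  have BS: "Q \<in> S" "Q \<in> D" "x \<in> Q" "owner Q = R" "Q \<subseteq> R" "R \<in> D" if "Q \<in> B" for Q
    using B S owner that by blast+
  have comparable: "Q \<subseteq> Q' \<or> Q' \<subseteq> Q" if "Q \<in> B" "Q' \<in> B" for Q Q'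
    using nested[of Q Q' x] BS that by blast
  have "card (B - stop R) \<le> 7"
  proof (cases "B - stop R = {}")
    case False
    then obtain Q0 where Q0: "Q0 \<in> B - stop R"
      and min: "\<forall>Q\<in>B - stop R. Q \<subseteq> Q0 \<longrightarrow> Q0 = Q"
      using finite_has_minimal[of "B - stop R"] fin by blast
    have sub: "B - stop R \<subseteq> {T \<in> S. Q0 \<subseteq> T \<and> T \<subseteq> R}"
    proof
      fix Q assume Q: "Q \<in> B - stop R"
      then have "Q0 \<subseteq> Q" using comparable[of Q0 Q] Q0 min by auto
      then show "Q \<in> {T \<in> S. Q0 \<subseteq> T \<and> T \<subseteq> R}"
        using Q BS(1,5)[of Q] by simp
    qed
    have Q0': "Q0 \<in> D" "Q0 \<subseteq> R" "R \<in> D" "Q0 \<notin> stop R" using Q0 BS(2,5,6)[of Q0] by auto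
    show ?thesis
    \<comment> \<open>Stopping concerns proper subcubes only, so for \<open>Q0 = R\<close> the
      crowding count says nothing; but then no other unstopped cube remains.\<close>
    proof (cases "Q0 = R")
      case True
      then have "B - stop R \<subseteq> {R}" using sub by blast
      then have "card (B - stop R) \<le> card {R}" by (intro card_mono) auto
      then show ?thesis by simp
    next
      case neq: False
      have "finite {T \<in> S. Q0 \<subseteq> T \<and> T \<subseteq> R}"
        by (rule finite_subset[OF _ finite_chain[OF Q0'(1,3)]]) (use S in blast)
      then have "card (B - stop R) \<le> card {T \<in> S. Q0 \<subseteq> T \<and> T \<subseteq> R}"
        using sub by (rule card_mono)
      also have "\<dots> \<le> 7" using Q0' neq by (auto simp: stop_def)
      finally show ?thesis .
    qed
  qed (simp only: card.empty)
  moreover have "card (B \<inter> stop R) \<le> m"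
  proof (cases "B \<inter> stop R = {}")
    case False
    then obtain Q1 where Q1: "Q1 \<in> B \<inter> stop R"
      and max: "\<forall>Q\<in>B \<inter> stop R. Q1 \<subseteq> Q \<longrightarrow> Q1 = Q"
      using finite_has_maximal[of "B \<inter> stop R"] fin by blast
    have Q1': "Q1 \<in> D" "R \<in> D" "Q1 \<in> stop R" "x \<in> Q1"
      using Q1 BS(2,3,6)[of Q1] by auto
    obtain T where T: "T \<in> maximal (stop R)" "Q1 \<subseteq> T"
      using stop_below_child[OF Q1'(2,3)] .
    have TD: "T \<in> D" using children[OF T(1)] by blast
    show ?thesis
    proof (rule card_scales_le)
      fix Q assume Q: "Q \<in> B \<inter> stop R"
      then have QB: "Q \<in> B" by blast
      note QS = BS[OF QB]
      show "x \<in> Q" by (rule QS)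
      have "Q \<subseteq> Q1" using comparable[OF QB, of Q1] Q Q1 max by auto
      then have le: "side_length Q \<le> side_length Q1" by (rule side_length_mono[OF QS(2) Q1'(1)])
      let ?Q = "dyadic_parent D m Q"
      note p = parent[OF QS(2), of m]
      \<comment> \<open>\<open>R\<close> is the stopping parent of \<open>?Q\<close>, and
        \<open>T\<close> is a child of \<open>R\<close>. Since \<open>?Q\<close> and
        \<open>T\<close> share \<open>x\<close>, nesting forces \<open>T\<close>, and with it
        \<open>Q1\<close>, strictly inside \<open>?Q\<close>.\<close>
      have "\<not> ?Q \<subseteq> T"
        using not_below_child_of_stopping_parent[OF p(1) parent_subset[OF QS(1)]] T(1) QS(4) by simp
      moreover have "x \<in> ?Q" "x \<in> T" using p(2) QS(3) T(2) Q1'(4) by blast+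
      ultimately have "T \<subset> ?Q" using nested[OF p(1) TD] by blast
      then have "Q1 \<subset> ?Q" using T(2) by blast
      then have "side_length Q1 < 2 ^ m * side_length Q"
        using side_length_strict_mono[OF Q1'(1) p(1)] p(3) by simp
      with le show "side_length Q \<le> side_length Q1 \<and> side_length Q1 < 2 ^ m * side_length Q"
        by simp
    qed (use BS(2) Q1' in auto)
  qed simp
  moreover have "card B = card (B - stop R) + card (B \<inter> stop R)"
    using card_Int_Diff[OF fin, of "stop R"] by simp
  ultimately show ?thesis by linarith
qed

lemma sparse_op_le:
  "sparse_op D m S f x \<le> ennreal (32 * (real m + 1)) * sparse_op D 0 principal f x"
proof -
  let ?a = "\<lambda>Q. ennreal (average f (dyadic_parent D m Q))"
  \<comment> \<open>The zeroth parent is kept to match the summand of \<open>sparse_op D 0\<close>;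
    it collapses to \<open>R\<close> by \<open>parent_0\<close>.\<close>
  let ?b = "\<lambda>R. ennreal (average f (dyadic_parent D 0 R)) * indicator R x"
  show ?thesis
    unfolding sparse_op_def[of D m]
  \<comment> \<open>Finite partial sums suffice, and they supply the finiteness that
    \<open>card_owner_le\<close> requires.\<close>
  proof (rule infsum_le_finite_sums)
    show "(\<lambda>Q. ?a Q * indicator Q x) summable_on S"
      by (rule nonneg_summable_on_complete) simp
    fix F assume F: "finite F" "F \<subseteq> S"
    define G where "G = {Q \<in> F. x \<in> Q}"
    have G: "finite G" "G \<subseteq> S" "\<And>Q. Q \<in> G \<Longrightarrow> x \<in> Q" using F by (auto simp: G_def)
    have "(\<Sum>Q\<in>F. ?a Q * indicator Q x) = (\<Sum>Q\<in>G. ?a Q)"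
      unfolding G_def using F by (intro sum.mono_neutral_cong_right) auto
    also have "\<dots> = (\<Sum>R\<in>owner ` G. \<Sum>Q | Q \<in> G \<and> owner Q = R. ?a Q)"
      using G(1) by (rule sum.image_gen)
    also have "\<dots> \<le> (\<Sum>R\<in>owner ` G. ennreal (32 * (real m + 1)) * ?b R)"
    proof (rule sum_mono)
      fix R assume "R \<in> owner ` G"
      then obtain Q where Q: "Q \<in> G" "R = owner Q" by blast
      then have QS: "Q \<in> S" "x \<in> Q" using G by auto
      have R: "R \<in> D" "R \<subseteq> P" "x \<in> R" using owner[OF QS(1)] QS(2) Q(2) by auto
      have R0: "average f R \<ge> 0" using R(2) nonneg by (intro average_nonneg) blast
      have c: "card {Q \<in> G. owner Q = R} \<le> 7 + m"
        by (rule card_owner_le[of _ x R]) (use G in auto)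
      have "(\<Sum>Q | Q \<in> G \<and> owner Q = R. ?a Q)
          \<le> of_nat (card {Q \<in> G. owner Q = R}) * ennreal (4 * average f R)"
        by (rule sum_bounded_above) (use average_parent_le G(2) in \<open>auto intro!: ennreal_leI\<close>)
      also have "\<dots> = ennreal (real (card {Q \<in> G. owner Q = R}) * (4 * average f R))"
        using R0 by (simp add: ennreal_mult ennreal_of_nat_eq_real_of_nat)
      \<comment> \<open>Here \<open>7 + m\<close> is at most \<open>8 * (m + 1)\<close>; with the
        factor 4 from the averages this produces 32.\<close>
      also have "\<dots> \<le> ennreal (8 * (real m + 1) * (4 * average f R))"
        using R0 c by (intro ennreal_leI mult_right_mono) auto
      also have "8 * (real m + 1) * (4 * average f R) = 32 * (real m + 1) * average f R" by simp
      also have "ennreal \<dots> = ennreal (32 * (real m + 1)) * ?b R"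
        using R R0 by (subst ennreal_mult) (auto simp: parent_0)
      finally show "(\<Sum>Q | Q \<in> G \<and> owner Q = R. ?a Q) \<le> ennreal (32 * (real m + 1)) * ?b R" .
    qed
    also have "\<dots> = ennreal (32 * (real m + 1)) * (\<Sum>R\<in>owner ` G. ?b R)"
      by (rule sum_distrib_left[symmetric])
    \<comment> \<open>The owners form a finite subfamily of \<open>principal\<close>, and the
      infinite sum is the supremum of such partial sums.\<close>
    also have "(\<Sum>R\<in>owner ` G. ?b R) \<le> sparse_op D 0 principal f x"
      unfolding sparse_op_def
      by (subst nonneg_infsum_complete) (use G owner(1) in \<open>auto intro!: SUP_upper\<close>)
    finally show "(\<Sum>Q\<in>F. ?a Q * indicator Q x)
        \<le> ennreal (32 * (real m + 1)) * sparse_op D 0 principal f x"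
      by (simp add: mult_left_mono)
  qed
qed

end

theorem theoremA:
  "\<exists>C::real. C > 0 \<and>
     (\<forall>D :: (real ^ 'n) set set. dyadic_grid D \<longrightarrow>
       (\<forall>(m::nat) P S.
          P \<in> D \<and> S \<subseteq> D \<and> sparse_collection S \<and> (\<forall>Q\<in>S. dyadic_parent D m Q \<subseteq> P) \<longrightarrow>
          (\<forall>f :: real ^ 'n \<Rightarrow> real.
             set_integrable lebesgue P f \<and> (\<forall>x\<in>P. f x \<ge> 0) \<longrightarrow>
             (\<exists>S'. S' \<subseteq> D \<and> (\<forall>Q\<in>S'. Q \<subseteq> P) \<and> sparse_collection S' \<and>
                (\<forall>x\<in>P. sparse_op D m S f x
                   \<le> ennreal (C * (real m + 1)) * sparse_op D 0 S' f x)))))"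
\<comment> \<open>The constant is the same in every dimension.\<close>
proof (intro exI[of _ "32::real"] conjI allI impI)
  fix D :: "(real ^ 'n) set set" and m :: nat and P S and f :: "real ^ 'n \<Rightarrow> real"
  assume "dyadic_grid D"
    and "P \<in> D \<and> S \<subseteq> D \<and> sparse_collection S \<and> (\<forall>Q\<in>S. dyadic_parent D m Q \<subseteq> P)"
    and "set_integrable lebesgue P f \<and> (\<forall>x\<in>P. f x \<ge> 0)"
  then interpret sparse_shift D P S f m
    by unfold_locales auto
  show "\<exists>S'. S' \<subseteq> D \<and> (\<forall>Q\<in>S'. Q \<subseteq> P) \<and> sparse_collection S' \<and>
      (\<forall>x\<in>P. sparse_op D m S f x \<le> ennreal (32 * (real m + 1)) * sparse_op D 0 S' f x)"
    by (intro exI[of _ principal] conjI ballI principal_sparse sparse_op_le)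
       (use principal_dyadic in auto)
qed simp

end
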